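(* Let $k$ be a field, let $q\in k^{\times}$ be not a root of unity, and let $n\ge 0$ be an integer. Let $P\subset A^{(n)}$ be a prime ideal containing neither of the two-sided ideals $\langle x,x',\dots,x^{(n)}\rangle$ and $\langle y,y',\dots,y^{(n)}\rangle$. Then $P=\langle T\rangle$, where $T$ is the family of all bi-homogeneous polynomials in $P$.
   Context: Let $B^{(n)}=k\langle x,x',\dots,x^{(n)},y,y',\dots,y^{(n)}\rangle$ be the free associative (noncommutative) unital $k$-algebra on the $2n+2$ indeterminates $x=x^{(0)},x'=x^{(1)},\dots,x^{(n)},y=y^{(0)},y'=y^{(1)},\dots,y^{(n)}$. Let $A^{(n)}$ be the quotient of $B^{(n)}$ by the two-sided ideal generated by all elements $x^{(i)}x^{(j)}-x^{(j)}x^{(i)}$, $\;y^{(i)}y^{(j)}-y^{(j)}y^{(i)}$, $\;y^{(i)}x^{(j)}-q\,x^{(j)}y^{(i)}$ for $0\le i,j\le n$. The classes of the ordered monomials $x^{i_0}(x')^{i_1}\cdots(x^{(n)})^{i_n}y^{j_0}(y')^{j_1}\cdots(y^{(n)})^{j_n}$ form a $k$-basis of $A^{(n)}$. The bi-degree of such a monomial is $(i_0+\dots+i_n,\;j_0+\dots+j_n)$. An element of $A^{(n)}$ is bi-homogeneous if it is a $k$-linear combination of such monomials all of the same bi-degree. Ideals of $A^{(n)}$ are two-sided, and $\langle S\rangle$ denotes the two-sided ideal generated by a set $S$. An ideal $P$ is prime if $P\ne(1)$ and $ab\in P$ implies $a\in P$ or $b\in P$ for all elements $a,b$. *)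

theory Defs
  imports "HOL-Library.Poly_Mapping" "HOL-Algebra.QuotRing"
begin

(* X i and Y i stand for the indeterminates x^(i) and y^(i). *)
datatype indet = X nat | Y nat

(* The free monoid on the indeterminates, written additively because
   Poly_Mapping's convolution product uses the monoid_add operation of the
   index type; addition of words is concatenation and is not commutative. *)
datatype word = Word (letters: "indet list")

instantiation word :: monoid_add
begin

definition zero_word :: word where
  "0 = Word []"

definition plus_word :: "word \<Rightarrow> word \<Rightarrow> word" where
  "u + v = Word (letters u @ letters v)"

instance
  by standard (simp_all add: zero_word_def plus_word_def)

end

definition indets :: "nat \<Rightarrow> indet set" where
  "indets n = X ` {..n} \<union> Y ` {..n}"

definition var :: "indet \<Rightarrow> word \<Rightarrow>\<^sub>0 'k::field" where
  "var v = Poly_Mapping.single (Word [v]) 1"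

definition const :: "'k::field \<Rightarrow> word \<Rightarrow>\<^sub>0 'k" where
  "const c = Poly_Mapping.single 0 c"

(* B^(n): the elements of the monoid algebra of the free monoid that involve
   only indeterminates of index at most n. *)
definition free_alg :: "nat \<Rightarrow> (word \<Rightarrow>\<^sub>0 'k::field) ring" where
  "free_alg n = \<lparr>carrier = {p. \<forall>w \<in> Poly_Mapping.keys p. set (letters w) \<subseteq> indets n},
     mult = (*), one = 1, zero = 0, add = (+)\<rparr>"

definition relations :: "nat \<Rightarrow> 'k::field \<Rightarrow> (word \<Rightarrow>\<^sub>0 'k) set" where
  "relations n q =
     {var (X i) * var (X j) - var (X j) * var (X i) | i j. i \<le> n \<and> j \<le> n} \<union>
     {var (Y i) * var (Y j) - var (Y j) * var (Y i) | i j. i \<le> n \<and> j \<le> n} \<union>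
     {var (Y i) * var (X j) - const q * (var (X j) * var (Y i)) | i j. i \<le> n \<and> j \<le> n}"

definition rel_ideal :: "nat \<Rightarrow> 'k::field \<Rightarrow> (word \<Rightarrow>\<^sub>0 'k) set" where
  "rel_ideal n q = genideal (free_alg n) (relations n q)"

(* A^(n).  In HOL-Algebra the locale ideal and the operator genideal are
   two-sided over an arbitrary, not necessarily commutative, ring. *)
definition quantum_alg :: "nat \<Rightarrow> 'k::field \<Rightarrow> (word \<Rightarrow>\<^sub>0 'k) set ring" where
  "quantum_alg n q = free_alg n Quot rel_ideal n q"

definition cls :: "nat \<Rightarrow> 'k::field \<Rightarrow> (word \<Rightarrow>\<^sub>0 'k) \<Rightarrow> (word \<Rightarrow>\<^sub>0 'k) set" where
  "cls n q p = rel_ideal n q +>\<^bsub>free_alg n\<^esub> p"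

definition smult :: "nat \<Rightarrow> 'k::field \<Rightarrow> 'k \<Rightarrow> (word \<Rightarrow>\<^sub>0 'k) set \<Rightarrow> (word \<Rightarrow>\<^sub>0 'k) set" where
  "smult n q c a = cls n q (const c) \<otimes>\<^bsub>quantum_alg n q\<^esub> a"

(* x^{i_0} (x')^{i_1} ... (x^(n))^{i_n} y^{j_0} (y')^{j_1} ... (y^(n))^{j_n};
   the values of i and j beyond n are irrelevant. *)
definition ord_word :: "nat \<Rightarrow> (nat \<Rightarrow> nat) \<Rightarrow> (nat \<Rightarrow> nat) \<Rightarrow> word" where
  "ord_word n i j =
     Word (concat (map (\<lambda>l. replicate (i l) (X l)) [0..<Suc n]) @
           concat (map (\<lambda>l. replicate (j l) (Y l)) [0..<Suc n]))"

definition ord_words :: "nat \<Rightarrow> nat \<times> nat \<Rightarrow> word set" where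
  "ord_words n d = {ord_word n i j | i j. ((\<Sum>l\<le>n. i l), (\<Sum>l\<le>n. j l)) = d}"

definition bihomogeneous :: "nat \<Rightarrow> 'k::field \<Rightarrow> (word \<Rightarrow>\<^sub>0 'k) set \<Rightarrow> bool" where
  "bihomogeneous n q f \<longleftrightarrow>
     (\<exists>d W c. finite W \<and> W \<subseteq> ord_words n d \<and>
        f = (\<Oplus>\<^bsub>quantum_alg n q\<^esub> w \<in> W. smult n q (c w) (cls n q (Poly_Mapping.single w 1))))"

(* HOL-Algebra's primeideal is restricted to commutative rings. *)
definition prime_ideal :: "('a, 'b) ring_scheme \<Rightarrow> 'a set \<Rightarrow> bool" where
  "prime_ideal R P \<longleftrightarrow> ideal P R \<and> P \<noteq> genideal R {\<one>\<^bsub>R\<^esub>} \<and>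
     (\<forall>a \<in> carrier R. \<forall>b \<in> carrier R. a \<otimes>\<^bsub>R\<^esub> b \<in> P \<longrightarrow> a \<in> P \<or> b \<in> P)"

lemma ring_free_alg: "ring (free_alg n :: (word \<Rightarrow>\<^sub>0 'k::field) ring)"
proof -
  let ?R = "free_alg n :: (word \<Rightarrow>\<^sub>0 'k) ring"
  have add: "p + r \<in> carrier ?R" if "p \<in> carrier ?R" "r \<in> carrier ?R" for p r
    using that Poly_Mapping.keys_add[of p r] unfolding free_alg_def by auto
  have mult: "p * r \<in> carrier ?R" if pr: "p \<in> carrier ?R" "r \<in> carrier ?R" for p r
  proof -
    have "set (letters w) \<subseteq> indets n" if "w \<in> Poly_Mapping.keys (p * r)" for w
    proof -
      obtain u v where "w = u + v" "u \<in> Poly_Mapping.keys p" "v \<in> Poly_Mapping.keys r"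
        using \<open>w \<in> Poly_Mapping.keys (p * r)\<close> keys_mult[of p r] by blast
      with pr show ?thesis by (simp add: free_alg_def plus_word_def)
    qed
    then show ?thesis by (simp add: free_alg_def)
  qed
  have inv: "\<exists>r \<in> carrier ?R. r + p = 0" if "p \<in> carrier ?R" for p
    using that by (intro bexI[of _ "- p"]) (simp_all add: free_alg_def)
  have zero: "0 \<in> carrier ?R" and one: "1 \<in> carrier ?R"
    by (simp_all add: free_alg_def zero_word_def)
  have ops: "mult ?R = (*)" "add ?R = (+)" "one ?R = 1" "zero ?R = 0"
    by (simp_all add: free_alg_def)
  show ?thesis
  proof (intro ringI)
    show "abelian_group ?R"
      by (rule abelian_groupI)
        (use add inv zero in \<open>simp_all add: ops add.assoc add.commute\<close>)
    show "Group.monoid ?R"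
      by (rule monoidI) (use mult one in \<open>simp_all add: ops mult.assoc\<close>)
  qed (simp_all add: ops distrib_left distrib_right)
qed

lemma relations_subset:
  fixes q :: "'k::field"
  shows "relations n q \<subseteq> carrier (free_alg n)"
proof -
  interpret ring "free_alg n :: (word \<Rightarrow>\<^sub>0 'k) ring"
    by (rule ring_free_alg)
  have v: "var v \<in> carrier (free_alg n :: (word \<Rightarrow>\<^sub>0 'k) ring)" if "v \<in> indets n" for v
    using that by (simp add: free_alg_def var_def)
  have c: "const c \<in> carrier (free_alg n :: (word \<Rightarrow>\<^sub>0 'k) ring)" for c
    by (simp add: free_alg_def const_def zero_word_def)
  have m: "p * r \<in> carrier (free_alg n :: (word \<Rightarrow>\<^sub>0 'k) ring)"
    if "p \<in> carrier (free_alg n)" "r \<in> carrier (free_alg n)" for p r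
    using m_closed[OF that] by (simp add: free_alg_def)
  have s: "p - r \<in> carrier (free_alg n :: (word \<Rightarrow>\<^sub>0 'k) ring)"
    if "p \<in> carrier (free_alg n)" "r \<in> carrier (free_alg n)" for p r
    using that Poly_Mapping.keys_diff[of p r] by (auto simp: free_alg_def)
  show ?thesis
    unfolding relations_def by (auto intro!: s m c v simp: indets_def)
qed

lemma ideal_rel_ideal: "ideal (rel_ideal n q) (free_alg n)"
  unfolding rel_ideal_def by (rule ring.genideal_ideal[OF ring_free_alg relations_subset])

lemma ring_quantum_alg: "ring (quantum_alg n q)"
  unfolding quantum_alg_def by (rule ideal.quotient_is_ring[OF ideal_rel_ideal])

end

theory Submission
  imports Defs "HOL.Vector_Spaces"
begin

text \<open>
  Since \<open>P\<close> does not contain the ideal generated by the \<open>X i\<close>, some indeterminate \<open>z = X i\<close>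
  lies outside \<open>P\<close>. In the quantum algebra \<open>z\<close> commutes with every word \<open>w\<close> up to the scalar
  \<open>q\<close> to the power of the \<open>Y\<close>-degree of \<open>w\<close>, so \<open>p z = z \<sigma>(p)\<close> for the linear map \<open>\<sigma>\<close> that
  multiplies each word by that scalar. If \<open>p \<in> P\<close> then \<open>z \<sigma>(p) \<in> P\<close>, and primeness
  gives \<open>\<sigma>(p) \<in> P\<close>: the subspace \<open>P\<close> is \<open>\<sigma>\<close>-invariant. The eigenvalues \<open>q\<^sup>b\<close> are pairwise
  distinct because \<open>q\<close> is not a root of unity, so \<open>P\<close> contains the eigencomponents of each of its
  elements, which are the components homogeneous in the \<open>Y\<close>-degree
  (\<open>invariant_subspace_eigencomponents\<close>, \<open>prime_ideal_component\<close>). Some \<open>Y j\<close> outside \<open>P\<close> splits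
  these components further by the \<open>X\<close>-degree in the same way. Hence every element of \<open>P\<close> is a sum
  of bi-homogeneous elements of \<open>P\<close>.

  The argument runs on representatives in the free algebra, where bi-degrees and components are
  those of words and exist without any choice; \<open>P\<close> is replaced by its preimage there. Back in the
  quantum algebra, the class of an element whose words all have one bi-degree is bi-homogeneous,
  because skew commutation sorts every word without changing its bi-degree (\<open>bihomogeneous_cls\<close>).
\<close>

section \<open>Eigenvectors in invariant subspaces\<close>

text \<open>
  Subtracting \<open>\<mu> c\<close> times the sum from its image under \<open>\<sigma>\<close> removes the summand \<open>f c\<close> and
  rescales every other summand by the nonzero factor \<open>\<mu> b - \<mu> c\<close>; induction on the number of
  summands finishes. This replaces the inversion of a Vandermonde matrix.
\<close>

lemma (in vector_space) invariant_subspace_eigencomponents: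
  assumes I: "subspace I" and lin: "module_hom scale scale \<sigma>" and inv: "\<sigma> ` I \<subseteq> I"
    and "finite B" "inj_on \<mu> B" "\<And>b. b \<in> B \<Longrightarrow> \<sigma> (f b) = scale (\<mu> b) (f b)"
    and "sum f B \<in> I" "b \<in> B"
  shows "f b \<in> I"
proof -
  interpret \<sigma>: module_hom scale scale \<sigma> by (rule lin)
  have "\<forall>b\<in>B. f b \<in> I"
    using assms(4-7)
  proof (induction B arbitrary: f rule: finite_induct)
    case empty
    then show ?case by simp
  next
    case (insert c B)
    let ?g = "\<lambda>b. scale (\<mu> b - \<mu> c) (f b)"
    have "sum ?g B = \<sigma> (sum f (insert c B)) - scale (\<mu> c) (sum f (insert c B))"
      using insert.hyps insert.prems(2)
      by (simp add: \<sigma>.add \<sigma>.sum scale_right_distrib scale_sum_right scale_left_diff_distrib sum_subtractf)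
    also have "\<dots> \<in> I"
      using inv insert.prems(3) by (intro subspace_diff[OF I] subspace_scale[OF I]) auto
    finally have g: "\<forall>b\<in>B. ?g b \<in> I"
      using insert.prems(1,2)
      by (intro insert.IH) (auto simp: \<sigma>.scale mult.commute)
    have B: "f b \<in> I" if "b \<in> B" for b
    proof -
      have "\<mu> b - \<mu> c \<noteq> 0"
        using insert.hyps(2) insert.prems(1) that by (auto simp: inj_on_def)
      with subspace_scale[OF I bspec[OF g that], of "inverse (\<mu> b - \<mu> c)"] show ?thesis
        by simp
    qed
    have "f c = sum f (insert c B) - sum f B"
      using insert.hyps by simp
    also have "\<dots> \<in> I"
      by (intro subspace_diff[OF I] insert.prems(3) subspace_sum[OF I] B)
    finally show ?case
      using B by blast
  qed
  with \<open>b \<in> B\<close> show ?thesis by blast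
qed

section \<open>The free algebra\<close>

abbreviation monomial :: "word \<Rightarrow> word \<Rightarrow>\<^sub>0 'k::field" where
  "monomial w \<equiv> Poly_Mapping.single w 1"

lemma lookup_const_mult: "Poly_Mapping.lookup (const c * p) w = c * Poly_Mapping.lookup p w"
  unfolding const_def
  by (simp add: mult_map_scale_conv_mult[symmetric] Poly_Mapping.map.rep_eq when_def)

interpretation free: vector_space "\<lambda>c p. const (c::'k::field) * p"
  by standard
    (auto intro!: poly_mapping_eqI simp: lookup_const_mult lookup_add algebra_simps)

lemma const_mult_const: "const c * const d = const (c * d)"
  by (simp add: const_def mult_single)

lemma const_1 [simp]: "const 1 = 1"
  by (simp add: const_def)

lemma const_mult_monomial: "const c * monomial w = Poly_Mapping.single w c"
  by (simp add: const_def mult_single)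

text \<open>
  The expansion of an element of the free algebra in the basis of words. It reduces statements
  that are linear in \<open>p\<close> to words.
\<close>

lemma sum_over_keys:
  "p = (\<Sum>w\<in>Poly_Mapping.keys p. const (Poly_Mapping.lookup p w) * monomial w)"
  by (rule poly_mapping_eqI)
    (auto simp: const_mult_monomial lookup_sum lookup_single when_def in_keys_iff)

lemma const_commutes: "p * const c = const c * (p :: word \<Rightarrow>\<^sub>0 'k::field)"
proof -
  let ?t = "\<lambda>w. const (Poly_Mapping.lookup p w) * monomial w"
  have "?t w * const c = const c * ?t w" for w
    by (simp add: const_def mult_single mult.commute)
  then have "sum ?t (Poly_Mapping.keys p) * const c = const c * sum ?t (Poly_Mapping.keys p)"
    by (simp only: sum_distrib_left sum_distrib_right)
  then show ?thesis
    unfolding sum_over_keys[of p, symmetric] .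
qed

lemma const_left_commute: "p * (const c * r) = const c * (p * (r :: word \<Rightarrow>\<^sub>0 'k::field))"
  by (simp only: mult.assoc[symmetric] const_commutes)

lemma monomial_append: "monomial (Word (us @ vs)) = monomial (Word us) * monomial (Word vs)"
  by (simp add: mult_single plus_word_def)

lemma monomial_Cons: "monomial (Word (v # vs)) = var v * monomial (Word vs)"
  by (simp add: var_def mult_single plus_word_def)

lemma monomial_Nil: "monomial (Word []) = 1"
  by (simp add: single_one zero_word_def[symmetric])

abbreviation C :: "nat \<Rightarrow> (word \<Rightarrow>\<^sub>0 'k::field) set" where
  "C n \<equiv> carrier (free_alg n)"

lemma free_alg_simps [simp]:
  "mult (free_alg n) = (*)" "add (free_alg n) = (+)" "one (free_alg n) = 1" "zero (free_alg n) = 0"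
  by (simp_all add: free_alg_def)

lemma free_alg_minus:
  fixes p r :: "word \<Rightarrow>\<^sub>0 'k::field"
  assumes "p \<in> C n" "r \<in> C n" shows "p \<ominus>\<^bsub>free_alg n\<^esub> r = p - r"
proof -
  interpret ring "free_alg n :: (word \<Rightarrow>\<^sub>0 'k) ring" by (rule ring_free_alg)
  have "- r \<in> C n" using assms by (simp add: free_alg_def)
  then have "\<ominus>\<^bsub>free_alg n\<^esub> r = - r"
    using assms minus_equality[of "- r" r] by simp
  then show ?thesis by (simp add: a_minus_def)
qed

lemma C_mult: "p \<in> C n \<Longrightarrow> r \<in> C n \<Longrightarrow> p * r \<in> C n"
  using monoid.m_closed[OF ring.is_monoid[OF ring_free_alg], of p n r] by simp

lemma C_const: "const c \<in> C n"
  by (simp add: free_alg_def const_def zero_word_def)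

lemma C_monomial: "set (letters w) \<subseteq> indets n \<Longrightarrow> monomial w \<in> C n"
  by (simp add: free_alg_def)

lemma C_var: "v \<in> indets n \<Longrightarrow> var v \<in> C n"
  by (simp add: free_alg_def var_def)

lemmas C_closed = C_mult C_const C_monomial C_var

lemma ideal_free_alg_subspace:
  assumes "ideal I (free_alg n)"
  shows "free.subspace I"
proof (rule free.subspaceI)
  interpret ideal I "free_alg n" by (rule assms)
  show "0 \<in> I"
    using additive_subgroup.zero_closed[OF ideal.axioms(1)[OF assms]] unfolding free_alg_simps .
  show "p + r \<in> I" if "p \<in> I" "r \<in> I" for p r
    using additive_subgroup.a_closed[OF ideal.axioms(1)[OF assms] that] unfolding free_alg_simps .
  show "const c * p \<in> I" if "p \<in> I" for c p
    using I_l_closed[OF that C_const] unfolding free_alg_simps .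
qed

lemma C_subspace: "free.subspace (C n)"
  by (rule ideal_free_alg_subspace[OF ring.oneideal[OF ring_free_alg]])

section \<open>Classes modulo the relations\<close>

lemma cls_hom: "ring_hom_ring (free_alg n) (quantum_alg n q) (cls n q)"
  unfolding quantum_alg_def cls_def[abs_def]
  by (rule ideal.rcos_ring_hom_ring[OF ideal_rel_ideal])

lemma cls_mult:
  assumes "p \<in> C n" "r \<in> C n"
  shows "cls n q (p * r) = cls n q p \<otimes>\<^bsub>quantum_alg n q\<^esub> cls n q r"
  using ring_hom_mult[OF ring_hom_ring.homh[OF cls_hom] assms] unfolding free_alg_simps .

lemma cls_add:
  assumes "p \<in> C n" "r \<in> C n"
  shows "cls n q (p + r) = cls n q p \<oplus>\<^bsub>quantum_alg n q\<^esub> cls n q r"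
  using ring_hom_add[OF ring_hom_ring.homh[OF cls_hom] assms] unfolding free_alg_simps .

lemma cls_0: "cls n q 0 = \<zero>\<^bsub>quantum_alg n q\<^esub>"
proof -
  interpret ring_hom_ring "free_alg n" "quantum_alg n q" "cls n q" by (rule cls_hom)
  show ?thesis using hom_zero by (simp only: free_alg_simps)
qed

lemma cls_closed: "p \<in> C n \<Longrightarrow> cls n q p \<in> carrier (quantum_alg n q)"
  by (rule ring_hom_closed[OF ring_hom_ring.homh[OF cls_hom]])

lemma carrier_quantum_alg: "carrier (quantum_alg n q) = cls n q ` C n"
  unfolding quantum_alg_def FactRing_def A_RCOSETS_def' cls_def[abs_def] partial_object.simps
  by (rule UNION_singleton_eq_range)

lemma cls_sum:
  assumes "finite W" "\<And>w. w \<in> W \<Longrightarrow> f w \<in> C n"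
  shows "cls n q (\<Sum>w\<in>W. f w) = (\<Oplus>\<^bsub>quantum_alg n q\<^esub>w\<in>W. cls n q (f w))"
proof -
  interpret A: ring "quantum_alg n q" by (rule ring_quantum_alg)
  show ?thesis
    using assms
  proof (induction W rule: finite_induct)
    case empty
    show ?case by (simp add: cls_0)
  next
    case (insert w W)
    have "(\<Sum>w\<in>W. f w) \<in> C n"
      using insert.prems by (intro free.subspace_sum[OF C_subspace]) auto
    then show ?case
      using insert by (subst A.finsum_insert) (auto simp: cls_add cls_closed)
  qed
qed

lemma cls_eq_iff:
  assumes "p \<in> C n" "r \<in> C n"
  shows "cls n q p = cls n q r \<longleftrightarrow> p - r \<in> rel_ideal n q"
  using ring.quotient_eq_iff_same_a_r_cos[OF ring_free_alg ideal_rel_ideal assms, of q]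
  unfolding cls_def free_alg_minus[OF assms] by (rule sym)

lemma cls_sum_cong:
  assumes "\<And>w. w \<in> W \<Longrightarrow> f w \<in> C n" "\<And>w. w \<in> W \<Longrightarrow> g w \<in> C n"
    and "\<And>w. w \<in> W \<Longrightarrow> cls n q (f w) = cls n q (g w)"
  shows "cls n q (sum f W) = cls n q (sum g W)"
proof -
  have "f w - g w \<in> rel_ideal n q" if "w \<in> W" for w
    using assms that cls_eq_iff by blast
  then have "sum f W - sum g W \<in> rel_ideal n q"
    unfolding sum_subtractf[symmetric]
    by (rule free.subspace_sum[OF ideal_free_alg_subspace[OF ideal_rel_ideal]])
  moreover have "sum f W \<in> C n" "sum g W \<in> C n"
    using assms(1,2) by (auto intro: free.subspace_sum[OF C_subspace])
  ultimately show ?thesis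
    by (simp only: cls_eq_iff)
qed

lemma cls_mult_left_cong:
  assumes "cls n q p = cls n q p'" "p \<in> C n" "p' \<in> C n" "r \<in> C n"
  shows "cls n q (p * r) = cls n q (p' * r)"
  using assms by (simp add: cls_mult)

lemma cls_mult_right_cong:
  assumes "cls n q p = cls n q p'" "p \<in> C n" "p' \<in> C n" "r \<in> C n"
  shows "cls n q (r * p) = cls n q (r * p')"
  using assms by (simp add: cls_mult)

lemma rel_in_rel_ideal: "r \<in> relations n q \<Longrightarrow> r \<in> rel_ideal n q"
  unfolding rel_ideal_def using ring.genideal_self[OF ring_free_alg relations_subset] by blast

lemma ideal_preimage_cls:
  assumes "ideal Q (quantum_alg n q)"
  shows "ideal {p \<in> C n. cls n q p \<in> Q} (free_alg n)"
  by (rule ring_hom_ring.ideal_vimage[OF cls_hom assms])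

section \<open>Skew commutation with the indeterminates\<close>

definition x_degree :: "word \<Rightarrow> nat" where
  "x_degree w = length (filter (\<lambda>v. v \<in> range X) (letters w))"

definition y_degree :: "word \<Rightarrow> nat" where
  "y_degree w = length (filter (\<lambda>v. v \<in> range Y) (letters w))"

lemma cls_var_mult_X:
  fixes q :: "'k::field"
  assumes "v \<in> indets n" "i \<le> n"
  shows "cls n q (var v * var (X i)) = cls n q (const (q ^ y_degree (Word [v])) * (var (X i) * var v))"
proof (subst cls_eq_iff)
  let ?r = "var v * var (X i) - const (q ^ y_degree (Word [v])) * (var (X i) * var v) :: word \<Rightarrow>\<^sub>0 'k"
  consider l where "v = X l" "l \<le> n" | l where "v = Y l" "l \<le> n"
    using assms by (auto simp: indets_def)
  then have "?r \<in> relations n q"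
  proof cases
    case (1 l)
    then have "?r = var (X l) * var (X i) - var (X i) * var (X l)"
      by (simp add: y_degree_def image_iff)
    with 1 assms(2) show ?thesis
      unfolding relations_def by blast
  next
    case (2 l)
    then have "?r = var (Y l) * var (X i) - const q * (var (X i) * var (Y l))"
      by (simp add: y_degree_def image_iff)
    with 2 assms(2) show ?thesis
      unfolding relations_def by blast
  qed
  then show "?r \<in> rel_ideal n q"
    by (rule rel_in_rel_ideal)
qed (use assms in \<open>auto intro!: C_closed simp: indets_def\<close>)

lemma cls_Y_mult_var:
  fixes q :: "'k::field"
  assumes "v \<in> indets n" "i \<le> n"
  shows "cls n q (var (Y i) * var v) = cls n q (const (q ^ x_degree (Word [v])) * (var v * var (Y i)))"
proof (subst cls_eq_iff)
  let ?r = "var (Y i) * var v - const (q ^ x_degree (Word [v])) * (var v * var (Y i)) :: word \<Rightarrow>\<^sub>0 'k"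
  consider l where "v = X l" "l \<le> n" | l where "v = Y l" "l \<le> n"
    using assms by (auto simp: indets_def)
  then have "?r \<in> relations n q"
  proof cases
    case (1 l)
    then have "?r = var (Y i) * var (X l) - const q * (var (X l) * var (Y i))"
      by (simp add: x_degree_def image_iff)
    with 1 assms(2) show ?thesis
      unfolding relations_def by blast
  next
    case (2 l)
    then have "?r = var (Y i) * var (Y l) - var (Y l) * var (Y i)"
      by (simp add: x_degree_def image_iff)
    with 2 assms(2) show ?thesis
      unfolding relations_def by blast
  qed
  then show "?r \<in> rel_ideal n q"
    by (rule rel_in_rel_ideal)
qed (use assms in \<open>auto intro!: C_closed simp: indets_def\<close>)

lemma y_degree_Cons: "y_degree (Word (v # vs)) = y_degree (Word [v]) + y_degree (Word vs)"
  by (simp add: y_degree_def image_iff)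

lemma x_degree_Cons: "x_degree (Word (v # vs)) = x_degree (Word [v]) + x_degree (Word vs)"
  by (simp add: x_degree_def image_iff)

text \<open>
  Moving \<open>X i\<close> to the left through a word costs one factor \<open>q\<close> for each \<open>Y\<close> it meets and nothing for
  an \<open>X\<close>. This makes \<open>X i\<close> detect the \<open>Y\<close>-degree.
\<close>

lemma cls_monomial_mult_X:
  fixes q :: "'k::field"
  assumes "set vs \<subseteq> indets n" and i: "i \<le> n"
  shows "cls n q (monomial (Word vs) * var (X i))
    = cls n q (const (q ^ y_degree (Word vs)) * (var (X i) * monomial (Word vs)))"
  using assms(1)
proof (induction vs)
  case Nil
  show ?case by (simp add: monomial_Nil y_degree_def)
next
  case (Cons v vs)
  let ?m = "monomial (Word vs) :: word \<Rightarrow>\<^sub>0 'k" and ?x = "var (X i) :: word \<Rightarrow>\<^sub>0 'k"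
  let ?b = "const (q ^ y_degree (Word vs))" and ?e = "const (q ^ y_degree (Word [v]))"
  have C: "?m \<in> C n" "?x \<in> C n" "var v \<in> C n"
    using Cons.prems i by (auto intro!: C_closed simp: indets_def)
  have "cls n q (monomial (Word (v # vs)) * ?x) = cls n q (var v * (?m * ?x))"
    by (simp add: monomial_Cons mult.assoc)
  also have "\<dots> = cls n q (var v * (?b * (?x * ?m)))"
    using Cons C by (intro cls_mult_right_cong Cons.IH C_mult C_const) auto
  also have "\<dots> = cls n q ((var v * ?x) * (?b * ?m))"
    by (simp only: const_left_commute[of ?x] const_left_commute[of "var v"] mult.assoc)
  also have "\<dots> = cls n q ((?e * (?x * var v)) * (?b * ?m))"
    using Cons.prems C i by (intro cls_mult_left_cong cls_var_mult_X C_mult C_const) auto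
  also have "(?e * (?x * var v)) * (?b * ?m) = (?e * ?b) * (?x * (var v * ?m))"
    by (simp only: const_left_commute[of ?x] const_left_commute[of "var v"] mult.assoc)
  also have "\<dots> = const (q ^ y_degree (Word (v # vs))) * (?x * monomial (Word (v # vs)))"
    by (simp add: const_mult_const monomial_Cons y_degree_Cons[of v vs] power_add)
  finally show ?case .
qed

text \<open>
  The mirror image: moving \<open>Y i\<close> to the right costs one factor \<open>q\<close> for each \<open>X\<close> it meets, so \<open>Y i\<close>
  detects the \<open>X\<close>-degree.
\<close>

lemma cls_Y_mult_monomial:
  fixes q :: "'k::field"
  assumes "set vs \<subseteq> indets n" and i: "i \<le> n"
  shows "cls n q (var (Y i) * monomial (Word vs))
    = cls n q (const (q ^ x_degree (Word vs)) * (monomial (Word vs) * var (Y i)))"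
  using assms(1)
proof (induction vs)
  case Nil
  show ?case by (simp add: monomial_Nil x_degree_def)
next
  case (Cons v vs)
  let ?m = "monomial (Word vs) :: word \<Rightarrow>\<^sub>0 'k" and ?y = "var (Y i) :: word \<Rightarrow>\<^sub>0 'k"
  let ?b = "const (q ^ x_degree (Word vs))" and ?e = "const (q ^ x_degree (Word [v]))"
  have C: "?m \<in> C n" "?y \<in> C n" "var v \<in> C n"
    using Cons.prems i by (auto intro!: C_closed simp: indets_def)
  have "cls n q (?y * monomial (Word (v # vs))) = cls n q ((?y * var v) * ?m)"
    by (simp add: monomial_Cons mult.assoc)
  also have "\<dots> = cls n q ((?e * (var v * ?y)) * ?m)"
    using Cons.prems C i by (intro cls_mult_left_cong cls_Y_mult_var C_mult C_const) auto
  also have "\<dots> = cls n q ((?e * var v) * (?y * ?m))"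
    by (simp add: mult.assoc)
  also have "\<dots> = cls n q ((?e * var v) * (?b * (?m * ?y)))"
    using Cons C by (intro cls_mult_right_cong Cons.IH C_mult C_const) auto
  also have "(?e * var v) * (?b * (?m * ?y)) = (?e * ?b) * ((var v * ?m) * ?y)"
    by (simp only: const_left_commute[of "var v"] mult.assoc)
  also have "\<dots> = const (q ^ x_degree (Word (v # vs))) * (monomial (Word (v # vs)) * ?y)"
    by (simp add: const_mult_const monomial_Cons x_degree_Cons[of v vs] power_add)
  finally show ?case .
qed

section \<open>Ordering words\<close>

text \<open>
  Raising one exponent of an ordered block inserts one letter; \<open>A\<close> and \<open>B\<close> are what stands before
  and after it. The block is the \<open>X\<close>-part or the \<open>Y\<close>-part of an ordered word, according to \<open>c\<close>.
\<close>

lemma concat_replicate_Suc: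
  fixes i :: "nat \<Rightarrow> nat"
  assumes "l \<le> n"
  obtains A B where "concat (map (\<lambda>l. replicate (i l) (c l)) [0..<Suc n]) = A @ B"
    and "concat (map (\<lambda>k. replicate ((i(l := Suc (i l))) k) (c k)) [0..<Suc n]) = A @ c l # B"
    and "set A \<union> set B \<subseteq> c ` {..n}"
proof
  let ?A = "concat (map (\<lambda>k. replicate (i k) (c k)) [0..<l])"
  let ?B = "replicate (i l) (c l) @ concat (map (\<lambda>k. replicate (i k) (c k)) [Suc l..<Suc n])"
  have upt: "[0..<Suc n] = [0..<l] @ l # [Suc l..<Suc n]"
    using assms upt_add_eq_append[of 0 l "Suc n - l"]
    by (simp add: upt_rec[of l])
  show "concat (map (\<lambda>l. replicate (i l) (c l)) [0..<Suc n]) = ?A @ ?B"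
    by (simp only: upt map_append concat_append list.map concat.simps)
  have "map (\<lambda>k. replicate ((i(l := Suc (i l))) k) (c k)) [0..<l] = map (\<lambda>k. replicate (i k) (c k)) [0..<l]"
    "map (\<lambda>k. replicate ((i(l := Suc (i l))) k) (c k)) [Suc l..<Suc n] = map (\<lambda>k. replicate (i k) (c k)) [Suc l..<Suc n]"
    by auto
  then show "concat (map (\<lambda>k. replicate ((i(l := Suc (i l))) k) (c k)) [0..<Suc n]) = ?A @ c l # ?B"
    by (simp only: upt map_append concat_append list.map concat.simps) simp
  show "set ?A \<union> set ?B \<subseteq> c ` {..n}"
    using assms by auto
qed

lemma ord_word_letters: "set (letters (ord_word n i j)) \<subseteq> indets n"
  by (auto simp: ord_word_def indets_def)

lemma degree_ord_word: "x_degree (ord_word n i j) = (\<Sum>l\<le>n. i l)" "y_degree (ord_word n i j) = (\<Sum>l\<le>n. j l)"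
  unfolding ord_word_def x_degree_def y_degree_def
  by (simp_all only: word.sel filter_append length_append filter_concat map_map length_concat)
    (auto simp: comp_def filter_replicate interv_sum_list_conv_sum_set_nat atLeast0LessThan
      lessThan_Suc_atMost image_iff simp del: upt_Suc)

text \<open>
  A letter in front of an ordered word can be moved to its place by skew commutation: an \<open>X l\<close> only
  passes other letters \<open>X\<close>, while a \<open>Y l\<close> passes the whole \<open>X\<close>-part, at the cost of a power of \<open>q\<close>,
  and then letters \<open>Y\<close>.
  Sorting never changes the bi-degree.
\<close>

lemma cls_var_mult_ord_word:
  fixes q :: "'k::field"
  assumes "v \<in> indets n"
  shows "\<exists>s i' j'. cls n q (var v * monomial (ord_word n i j)) = cls n q (const s * monomial (ord_word n i' j'))
    \<and> x_degree (ord_word n i' j') = x_degree (Word [v]) + x_degree (ord_word n i j)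
    \<and> y_degree (ord_word n i' j') = y_degree (Word [v]) + y_degree (ord_word n i j)"
proof -
  consider l where "v = X l" "l \<le> n" | l where "v = Y l" "l \<le> n"
    using assms by (auto simp: indets_def)
  then show ?thesis
  proof cases
    case 1
    let ?ys = "concat (map (\<lambda>l. replicate (j l) (Y l)) [0..<Suc n])"
    obtain A B where AB: "concat (map (\<lambda>l. replicate (i l) (X l)) [0..<Suc n]) = A @ B"
      "concat (map (\<lambda>k. replicate ((i(l := Suc (i l))) k) (X k)) [0..<Suc n]) = A @ X l # B"
      "set A \<union> set B \<subseteq> X ` {..n}"
      using concat_replicate_Suc[OF 1(2), of i X] by metis
    have o: "ord_word n i j = Word (A @ (B @ ?ys))"
      "ord_word n (i(l := Suc (i l))) j = Word (A @ (X l # B @ ?ys))"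
      unfolding ord_word_def AB by simp_all
    have "set (B @ ?ys) \<subseteq> indets n" "set A \<subseteq> indets n"
      using AB(3) by (auto simp: indets_def)
    moreover have "y_degree (Word A) = 0"
      using AB(3) by (auto simp: y_degree_def filter_empty_conv)
    ultimately have "cls n q ((monomial (Word A) * var (X l)) * monomial (Word (B @ ?ys)))
        = cls n q ((var (X l) * monomial (Word A)) * monomial (Word (B @ ?ys)))"
      using 1 assms cls_monomial_mult_X[of A n l q] by (intro cls_mult_left_cong C_mult C_monomial C_var) auto
    then have "cls n q (var v * monomial (ord_word n i j)) = cls n q (const 1 * monomial (ord_word n (i(l := Suc (i l))) j))"
      unfolding o monomial_append monomial_Cons using 1 by (simp add: mult.assoc monomial_append)
    moreover have "x_degree (ord_word n (i(l := Suc (i l))) j) = x_degree (Word [v]) + x_degree (ord_word n i j)"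
      "y_degree (ord_word n (i(l := Suc (i l))) j) = y_degree (Word [v]) + y_degree (ord_word n i j)"
      unfolding o by (auto simp: 1 x_degree_def y_degree_def)
    ultimately show ?thesis by blast
  next
    case 2
    let ?xs = "concat (map (\<lambda>l. replicate (i l) (X l)) [0..<Suc n])"
    obtain A B where AB: "concat (map (\<lambda>l. replicate (j l) (Y l)) [0..<Suc n]) = A @ B"
      "concat (map (\<lambda>k. replicate ((j(l := Suc (j l))) k) (Y k)) [0..<Suc n]) = A @ Y l # B"
      "set A \<union> set B \<subseteq> Y ` {..n}"
      using concat_replicate_Suc[OF 2(2), of j Y] by metis
    have o: "ord_word n i j = Word ((?xs @ A) @ B)"
      "ord_word n i (j(l := Suc (j l))) = Word ((?xs @ A) @ (Y l # B))"
      unfolding ord_word_def AB by simp_all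
    let ?s = "q ^ x_degree (Word (?xs @ A))"
    have "set (?xs @ A) \<subseteq> indets n" "set B \<subseteq> indets n"
      using AB(3) by (auto simp: indets_def)
    then have "cls n q ((var (Y l) * monomial (Word (?xs @ A))) * monomial (Word B))
        = cls n q ((const ?s * (monomial (Word (?xs @ A)) * var (Y l))) * monomial (Word B))"
      using 2 assms by (intro cls_mult_left_cong cls_Y_mult_monomial C_closed) auto
    then have "cls n q (var v * monomial (ord_word n i j)) = cls n q (const ?s * monomial (ord_word n i (j(l := Suc (j l)))))"
      unfolding o monomial_append[of "?xs @ A"] monomial_Cons using 2 by (simp only: mult.assoc)
    moreover have "x_degree (ord_word n i (j(l := Suc (j l)))) = x_degree (Word [v]) + x_degree (ord_word n i j)"
      "y_degree (ord_word n i (j(l := Suc (j l)))) = y_degree (Word [v]) + y_degree (ord_word n i j)"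
      unfolding o by (auto simp: 2 x_degree_def y_degree_def)
    ultimately show ?thesis by blast
  qed
qed

text \<open>
  Insertion sort: the first letter is inserted into the sorted tail, so ordered monomials span the
  quantum algebra within each bi-degree.
\<close>

lemma cls_monomial_eq_ordered:
  fixes q :: "'k::field"
  assumes "set vs \<subseteq> indets n"
  shows "\<exists>s i j. cls n q (monomial (Word vs)) = cls n q (const s * monomial (ord_word n i j))
    \<and> x_degree (ord_word n i j) = x_degree (Word vs) \<and> y_degree (ord_word n i j) = y_degree (Word vs)"
  using assms
proof (induction vs)
  case Nil
  have "ord_word n (\<lambda>_. 0) (\<lambda>_. 0) = Word []"
    by (simp add: ord_word_def)
  then show ?case
    by (metis const_1 mult_1)
next
  case (Cons v vs)
  then obtain s i j where s: "cls n q (monomial (Word vs)) = cls n q (const s * monomial (ord_word n i j))"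
    "x_degree (ord_word n i j) = x_degree (Word vs)" "y_degree (ord_word n i j) = y_degree (Word vs)"
    by auto
  have v: "v \<in> indets n" using Cons.prems by simp
  from cls_var_mult_ord_word[OF this, of q i j] obtain t i' j'
    where t: "cls n q (var v * monomial (ord_word n i j)) = cls n q (const t * monomial (ord_word n i' j'))"
    "x_degree (ord_word n i' j') = x_degree (Word [v]) + x_degree (ord_word n i j)"
    "y_degree (ord_word n i' j') = y_degree (Word [v]) + y_degree (ord_word n i j)"
    by blast
  note C = C_closed ord_word_letters v
  have "cls n q (monomial (Word (v # vs))) = cls n q (var v * monomial (Word vs))"
    by (simp add: monomial_Cons)
  also have "\<dots> = cls n q (var v * (const s * monomial (ord_word n i j)))"
    using Cons.prems by (intro cls_mult_right_cong s(1) C) auto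
  also have "\<dots> = cls n q (const s * (var v * monomial (ord_word n i j)))"
    by (simp only: const_left_commute)
  also have "\<dots> = cls n q (const s * (const t * monomial (ord_word n i' j')))"
    by (intro cls_mult_right_cong t(1) C)
  also have "\<dots> = cls n q (const (s * t) * monomial (ord_word n i' j'))"
    by (simp only: mult.assoc[symmetric] const_mult_const)
  finally show ?case
    using s t x_degree_Cons[of v vs] y_degree_Cons[of v vs] by metis
qed

text \<open>
  Sorting each word separately may send different words to the same ordered word, and
  \<open>bihomogeneous\<close> sums over a set of ordered words; the coefficients in each fibre of the sorting map
  are therefore collected.
\<close>

lemma bihomogeneous_cls:
  fixes q :: "'k::field"
  assumes "p \<in> C n" and deg: "\<And>w. w \<in> Poly_Mapping.keys p \<Longrightarrow> x_degree w = a \<and> y_degree w = b"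
  shows "bihomogeneous n q (cls n q p)"
proof -
  let ?K = "Poly_Mapping.keys p" and ?c = "Poly_Mapping.lookup p"
  have K: "set (letters w) \<subseteq> indets n" if "w \<in> ?K" for w
    using assms(1) that by (simp add: free_alg_def)
  have "\<exists>s v. v \<in> ord_words n (a, b) \<and> cls n q (monomial w) = cls n q (const s * monomial v)" if "w \<in> ?K" for w
    using cls_monomial_eq_ordered[OF K[OF that], of q] deg[OF that]
    by (auto simp: ord_words_def degree_ord_word)
  then obtain s v where v: "v w \<in> ord_words n (a, b)"
    "cls n q (monomial w) = cls n q (const (s w) * monomial (v w))" if "w \<in> ?K" for w
    by metis
  have vC: "monomial (v w) \<in> C n" if "w \<in> ?K" for w
    using v(1)[OF that] by (auto simp: ord_words_def intro!: C_monomial dest: subsetD[OF ord_word_letters])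
  define W where "W = v ` ?K"
  define d where "d u = (\<Sum>w | w \<in> ?K \<and> v w = u. ?c w * s w)" for u
  have W: "finite W" "W \<subseteq> ord_words n (a, b)"
    using v(1) by (auto simp: W_def)
  have WC: "monomial u \<in> C n" if "u \<in> W" for u
    using that vC by (auto simp: W_def)
  have "cls n q p = cls n q (\<Sum>w\<in>?K. const (?c w) * monomial w)"
    by (rule arg_cong[OF sum_over_keys])
  also have "\<dots> = cls n q (\<Sum>w\<in>?K. const (?c w) * (const (s w) * monomial (v w)))"
    by (intro cls_sum_cong cls_mult_right_cong v(2) C_mult C_const C_monomial K vC)
  also have "(\<Sum>w\<in>?K. const (?c w) * (const (s w) * monomial (v w)))
      = (\<Sum>w\<in>?K. const (?c w * s w) * monomial (v w))"
    by (simp only: mult.assoc[symmetric] const_mult_const)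
  also have "\<dots> = (\<Sum>u\<in>W. \<Sum>w | w \<in> ?K \<and> v w = u. const (?c w * s w) * monomial (v w))"
    unfolding W_def by (rule sum.image_gen) simp
  also have "\<dots> = (\<Sum>u\<in>W. const (d u) * monomial u)"
    unfolding d_def free.scale_sum_left by (intro sum.cong) auto
  also have "cls n q \<dots> = (\<Oplus>\<^bsub>quantum_alg n q\<^esub>u\<in>W. cls n q (const (d u) * monomial u))"
    by (intro cls_sum W C_mult C_const WC)
  also have "\<dots> = (\<Oplus>\<^bsub>quantum_alg n q\<^esub>u\<in>W. smult n q (d u) (cls n q (monomial u)))"
  proof -
    interpret A: ring "quantum_alg n q" by (rule ring_quantum_alg)
    have "smult n q (d u) (cls n q (monomial u)) = cls n q (const (d u) * monomial u)" if "u \<in> W" for u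
      unfolding smult_def by (rule cls_mult[OF C_const WC[OF that], symmetric])
    then show ?thesis
      using WC by (intro A.finsum_cong') (auto intro!: cls_closed C_mult C_const)
  qed
  finally show ?thesis
    unfolding bihomogeneous_def using W by blast
qed

section \<open>Rescaling words and homogeneous components\<close>

text \<open>
  The diagonal linear map that has the word \<open>w\<close> as an eigenvector with eigenvalue \<open>\<chi> w\<close>. It
  provides both the operator \<open>\<sigma>\<close> of the main argument and, for an indicator function \<open>\<chi>\<close>, the
  projection to a homogeneous component.
\<close>

definition twist :: "(word \<Rightarrow> 'k::field) \<Rightarrow> (word \<Rightarrow>\<^sub>0 'k) \<Rightarrow> word \<Rightarrow>\<^sub>0 'k" where
  "twist \<chi> p = Poly_Mapping.mapp (\<lambda>w. (*) (\<chi> w)) p"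

lemma lookup_twist: "Poly_Mapping.lookup (twist \<chi> p) w = \<chi> w * Poly_Mapping.lookup p w"
  by (auto simp: twist_def lookup_mapp when_def in_keys_iff)

lemma twist_linear: "module_hom (\<lambda>c p. const c * p) (\<lambda>c p. const c * p) (twist \<chi>)"
  by (intro_locales, unfold_locales)
    (auto intro!: poly_mapping_eqI simp: lookup_twist lookup_add lookup_const_mult algebra_simps)

lemma keys_twist: "Poly_Mapping.keys (twist \<chi> p) \<subseteq> Poly_Mapping.keys p"
  by (simp add: twist_def keys_mapp_subset)

lemma twist_closed: "p \<in> C n \<Longrightarrow> twist \<chi> p \<in> C n"
  using keys_twist[of \<chi> p] by (auto simp: free_alg_def)

definition component :: "(word \<Rightarrow> 'd) \<Rightarrow> 'd \<Rightarrow> (word \<Rightarrow>\<^sub>0 'k::field) \<Rightarrow> word \<Rightarrow>\<^sub>0 'k" where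
  "component deg d = twist (\<lambda>w. of_bool (deg w = d))"

lemma keys_component: "Poly_Mapping.keys (component deg d p) = {w \<in> Poly_Mapping.keys p. deg w = d}"
  by (auto simp: component_def in_keys_iff lookup_twist)

lemma sum_components: "p = (\<Sum>d\<in>deg ` Poly_Mapping.keys p. component deg d p)"
proof (rule poly_mapping_eqI)
  fix w
  have "(\<Sum>d\<in>deg ` Poly_Mapping.keys p. of_bool (deg w = d) * Poly_Mapping.lookup p w) = Poly_Mapping.lookup p w"
    by (cases "w \<in> Poly_Mapping.keys p")
      (auto simp: in_keys_iff of_bool_def if_distrib[of "\<lambda>x. x * _"] sum.delta cong: if_cong)
  then show "Poly_Mapping.lookup p w = Poly_Mapping.lookup (\<Sum>d\<in>deg ` Poly_Mapping.keys p. component deg d p) w"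
    by (simp add: lookup_sum component_def lookup_twist)
qed

lemma component_closed: "p \<in> C n \<Longrightarrow> component deg d p \<in> C n"
  unfolding component_def by (rule twist_closed)

text \<open>
  The components of \<open>p\<close> are eigenvectors of the twist for the distinct eigenvalues \<open>\<mu> d\<close>, so an
  invariant subspace that contains their sum \<open>p\<close> contains each of them.
\<close>

lemma component_in_invariant_subspace:
  assumes "free.subspace I" "twist (\<lambda>w. \<mu> (deg w)) ` I \<subseteq> I" "inj \<mu>" "p \<in> I"
  shows "component deg d p \<in> I"
proof (cases "d \<in> deg ` Poly_Mapping.keys p")
  case True
  show ?thesis
  proof (rule free.invariant_subspace_eigencomponents[where f = "\<lambda>d. component deg d p" and \<mu> = \<mu>])
    show "twist (\<lambda>w. \<mu> (deg w)) (component deg e p) = const (\<mu> e) * component deg e p" for e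
      by (rule poly_mapping_eqI) (simp add: component_def lookup_twist lookup_const_mult)
  qed (use assms True sum_components[of p deg, symmetric] twist_linear inj_on_subset[OF \<open>inj \<mu>\<close>] in auto)
next
  case False
  then have "component deg d p = 0"
    using keys_component[of deg d p] by (auto simp flip: keys_eq_empty)
  then show ?thesis
    using assms(1) by (simp add: free.subspace_0)
qed

section \<open>Prime ideals\<close>

text \<open>
  Skew commutation of \<open>z\<close> with words extends linearly: moving \<open>z\<close> past \<open>p\<close> twists \<open>p\<close>.
\<close>

lemma twist_mod_rel_ideal:
  assumes z: "z \<in> C n" and p: "p \<in> C n"
    and skew: "\<And>w. set (letters w) \<subseteq> indets n \<Longrightarrow> monomial w * z - const (\<chi> w) * (z * monomial w) \<in> rel_ideal n q"
  shows "cls n q (p * z) = cls n q (z * twist \<chi> p)"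
proof -
  let ?K = "Poly_Mapping.keys p" and ?c = "Poly_Mapping.lookup p"
  have tw: "twist \<chi> p = (\<Sum>w\<in>?K. const (?c w) * (const (\<chi> w) * monomial w))"
  proof -
    interpret t: module_hom "\<lambda>c p. const c * p" "\<lambda>c p. const c * p" "twist \<chi>" by (rule twist_linear)
    have "twist \<chi> (monomial w) = const (\<chi> w) * monomial w" for w
      by (rule poly_mapping_eqI) (simp add: lookup_twist lookup_const_mult lookup_single when_def)
    then show ?thesis
      by (subst sum_over_keys[of p]) (simp only: t.sum t.scale)
  qed
  have "p * z - z * twist \<chi> p = (\<Sum>w\<in>?K. const (?c w) * monomial w) * z - z * twist \<chi> p"
    by (simp only: sum_over_keys[symmetric])
  also have "\<dots> = (\<Sum>w\<in>?K. const (?c w) * (monomial w * z - const (\<chi> w) * (z * monomial w)))"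
    unfolding tw
    by (simp add: sum_distrib_left sum_distrib_right sum_subtractf const_left_commute[of z] mult.assoc right_diff_distrib)
  also have "\<dots> \<in> rel_ideal n q"
  proof (intro free.subspace_sum free.subspace_scale ideal_free_alg_subspace[OF ideal_rel_ideal] skew)
    show "set (letters w) \<subseteq> indets n" if "w \<in> ?K" for w
      using p that by (simp add: free_alg_def)
  qed
  finally show ?thesis
    using z p by (simp add: cls_eq_iff C_mult twist_closed)
qed

text \<open>
  The heart of the proof. For \<open>r\<close> with class in \<open>P\<close> the product \<open>z \<cdot> twist r\<close> has the same class as
  \<open>r z\<close>, which lies in \<open>P\<close>; cancelling \<open>z \<notin> P\<close> by primeness shows that the preimage of \<open>P\<close> is
  stable under the twist.
\<close>

lemma prime_ideal_component:
  assumes P: "prime_ideal (quantum_alg n q) P"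
    and z: "z \<in> C n" "cls n q z \<notin> P"
    and skew: "\<And>w. set (letters w) \<subseteq> indets n \<Longrightarrow>
      monomial w * z - const (\<mu> (deg w)) * (z * monomial w) \<in> rel_ideal n q"
    and "inj \<mu>" and p: "p \<in> C n" "cls n q p \<in> P"
  shows "cls n q (component deg d p) \<in> P"
proof -
  let ?I = "{p \<in> C n. cls n q p \<in> P}"
  have P': "ideal P (quantum_alg n q)"
    using P by (simp add: prime_ideal_def)
  have "twist (\<lambda>w. \<mu> (deg w)) r \<in> ?I" if r: "r \<in> ?I" for r
  proof -
    let ?t = "twist (\<lambda>w. \<mu> (deg w)) r"
    have "cls n q z \<otimes>\<^bsub>quantum_alg n q\<^esub> cls n q ?t = cls n q (r * z)"
      using r z twist_mod_rel_ideal[OF z(1) _ skew, of r] by (simp add: cls_mult twist_closed)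
    also have "\<dots> \<in> P"
      using r z ideal.I_r_closed[OF P'] by (simp add: cls_mult cls_closed)
    finally have "cls n q ?t \<in> P"
      using P z r cls_closed[OF z(1), of q] cls_closed[OF twist_closed, of r n q "\<lambda>w. \<mu> (deg w)"]
      unfolding prime_ideal_def by blast
    then show ?thesis
      using r by (simp add: twist_closed)
  qed
  then have "component deg d p \<in> ?I"
    using p \<open>inj \<mu>\<close>
    by (intro component_in_invariant_subspace ideal_free_alg_subspace[OF ideal_preimage_cls[OF P']]) auto
  then show ?thesis by simp
qed

lemma inj_power_not_root_of_unity:
  fixes q :: "'k::field"
  assumes "q \<noteq> 0" "\<And>m. m > 0 \<Longrightarrow> q ^ m \<noteq> 1"
  shows "inj ((^) q :: nat \<Rightarrow> 'k)"
proof (rule linorder_injI)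
  fix a b :: nat assume "a < b"
  then have "q ^ b = q ^ a * q ^ (b - a)" by (simp flip: power_add)
  with assms(2)[of "b - a"] \<open>a < b\<close> \<open>q \<noteq> 0\<close> show "q ^ a \<noteq> q ^ b" by simp
qed

theorem theorem3:
  fixes q :: "'k::field" and n :: nat and P :: "(word \<Rightarrow>\<^sub>0 'k) set set"
  assumes "q \<noteq> 0"
    and "\<And>m. m > 0 \<Longrightarrow> q ^ m \<noteq> 1"
    and "prime_ideal (quantum_alg n q) P"
    and "\<not> genideal (quantum_alg n q) {cls n q (var (X i)) | i. i \<le> n} \<subseteq> P"
    and "\<not> genideal (quantum_alg n q) {cls n q (var (Y i)) | i. i \<le> n} \<subseteq> P"
  shows "P = genideal (quantum_alg n q) {f \<in> P. bihomogeneous n q f}"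
proof
  interpret A: ring "quantum_alg n q" by (rule ring_quantum_alg)
  have P: "ideal P (quantum_alg n q)"
    using assms(3) by (simp add: prime_ideal_def)
  let ?T = "{f \<in> P. bihomogeneous n q f}"
  show "genideal (quantum_alg n q) ?T \<subseteq> P"
    by (rule A.genideal_minimal[OF P]) blast
  obtain i where i: "i \<le> n" "cls n q (var (X i)) \<notin> P"
  proof -
    have "\<not> {cls n q (var (X i)) | i. i \<le> n} \<subseteq> P"
      by (rule contrapos_nn[OF assms(4) A.genideal_minimal[OF P]])
    then show ?thesis using that by auto
  qed
  obtain j where j: "j \<le> n" "cls n q (var (Y j)) \<notin> P"
  proof -
    have "\<not> {cls n q (var (Y i)) | i. i \<le> n} \<subseteq> P"
      by (rule contrapos_nn[OF assms(5) A.genideal_minimal[OF P]])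
    then show ?thesis using that by auto
  qed
  have inj: "inj ((^) q :: nat \<Rightarrow> 'k)" "inj (\<lambda>a. inverse (q ^ a))"
    using inj_power_not_root_of_unity[OF assms(1,2)] by (auto simp: inj_def)
  have C: "var (X i) \<in> C n" "var (Y j) \<in> C n"
    using i j by (auto intro!: C_var simp: indets_def)
  have skew_X: "monomial w * var (X i) - const (q ^ y_degree w) * (var (X i) * monomial w) \<in> rel_ideal n q"
    if "set (letters w) \<subseteq> indets n" for w
    by (intro iffD1[OF cls_eq_iff] cls_monomial_mult_X[OF that i(1), unfolded word.collapse]
        C_mult C_const C_monomial C that)
  have skew_Y: "monomial w * var (Y j) - const (inverse (q ^ x_degree w)) * (var (Y j) * monomial w) \<in> rel_ideal n q"
    if "set (letters w) \<subseteq> indets n" for w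
  proof -
    let ?a = "q ^ x_degree w"
    have "var (Y j) * monomial w - const ?a * (monomial w * var (Y j)) \<in> rel_ideal n q"
      by (intro iffD1[OF cls_eq_iff] cls_Y_mult_monomial[OF that j(1), unfolded word.collapse]
          C_mult C_const C_monomial C that)
    \<comment> \<open>Scaling by \<open>- 1 / ?a\<close> turns the relation for \<open>Y j\<close> on the left of \<open>w\<close> into one for \<open>Y j\<close> on the right.\<close>
    then have "const (- inverse ?a) * (var (Y j) * monomial w - const ?a * (monomial w * var (Y j))) \<in> rel_ideal n q"
      by (rule free.subspace_scale[OF ideal_free_alg_subspace[OF ideal_rel_ideal]])
    also have "const (- inverse ?a) * (var (Y j) * monomial w - const ?a * (monomial w * var (Y j)))
      = monomial w * var (Y j) - const (inverse ?a) * (var (Y j) * monomial w)"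
      using \<open>q \<noteq> 0\<close> by (intro poly_mapping_eqI) (simp add: lookup_const_mult lookup_minus field_simps)
    finally show ?thesis .
  qed
  let ?G = "genideal (quantum_alg n q) ?T"
  have T: "?T \<subseteq> carrier (quantum_alg n q)"
    using additive_subgroup.a_subset[OF ideal.axioms(1)[OF P]] by blast
  note G = A.genideal_ideal[OF T]
  show "P \<subseteq> ?G"
  proof
    fix f assume "f \<in> P"
    with additive_subgroup.a_subset[OF ideal.axioms(1)[OF P]] obtain p
      where p: "p \<in> C n" "f = cls n q p" by (auto simp: carrier_quantum_alg)
    let ?c = "\<lambda>b a. component x_degree a (component y_degree b p)"
    have cP: "cls n q (?c b a) \<in> P" for a b
    proof -
      have "cls n q (component y_degree b p) \<in> P"
        using \<open>f \<in> P\<close> p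
        by (intro prime_ideal_component[where \<mu> = "(^) q", OF assms(3) C(1) i(2) skew_X inj(1)]) auto
      then show ?thesis
        using p(1)
        by (intro prime_ideal_component[where \<mu> = "\<lambda>a. inverse (q ^ a)", OF assms(3) C(2) j(2) skew_Y inj(2)]
            component_closed)
    qed
    have "bihomogeneous n q (cls n q (?c b a))" for a b
      using p by (intro bihomogeneous_cls[where a = a and b = b] component_closed) (auto simp: keys_component)
    then have cG: "?c b a \<in> {p \<in> C n. cls n q p \<in> ?G}" for a b
      using cP A.genideal_self[OF T] p(1) by (auto intro!: component_closed)
    note sub = free.subspace_sum[OF ideal_free_alg_subspace[OF ideal_preimage_cls[OF G]]]
    have "component y_degree b p \<in> {p \<in> C n. cls n q p \<in> ?G}" for b
      by (subst sum_components[of _ x_degree], intro sub cG)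
    then have "p \<in> {p \<in> C n. cls n q p \<in> ?G}"
      by (subst sum_components[of _ y_degree], intro sub)
    then show "f \<in> ?G"
      using p by simp
  qed
qed

end
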